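(* Let $n \ge 4$, and let $\mathrm{st}_{\le n}$ be a weakly bicompatible permutation statistic defined on permutations of length at most $n$ whose restriction $\mathrm{st}_{\le n-1}$ to permutations of length at most $n-1$ is trivial. (i) If $n = p^k$ for some prime $p$ and some $k \ge 1$, then the restriction $\mathrm{st}_n$ of the statistic to permutations of length $n$ has at most $p$ equivalence classes. (ii) Otherwise (i.e. if $n$ is not a power of a prime), $\mathrm{st}_n$ is trivial.
   Context: A permutation is a finite (possibly empty) sequence $\pi = \pi_1 \cdots \pi_n$ of distinct positive integers, called its letters; $|\pi| = n$ is its length. Permutations $\pi,\sigma$ of the same length have the same relative order if $\pi_i<\pi_j \iff \sigma_i<\sigma_j$ for all $i,j$. A permutation statistic defined on length $\le n$ is a function $\mathrm{st}_{\le n}$ on the permutations of length at most $n$ that takes equal values on permutations with the same relative order. Write $\pi \sim_{\mathrm{st}} \sigma$ if $|\pi| = |\sigma|$ and $\mathrm{st}(\pi) = \mathrm{st}(\sigma)$; the equivalence classes of a statistic on length $n$ are those of $\sim_{\mathrm{st}}$ on permutations of length $n$. A statistic (on given lengths) is trivial if $\pi\sim_{\mathrm{st}}\sigma$ for all $\pi,\sigma$ of equal length in its domain. Permutations $\pi,\sigma$ are disjoint if they have no letters in common; then the shuffle set $\pi ⧢ \sigma$ is the set of all $\binom{|\pi|+|\sigma|}{|\pi|}$ permutations of length $|\pi|+|\sigma|$ containing both $\pi$ and $\sigma$ as subsequences. Write $\pi < \sigma$ if every letter of $\pi$ is strictly less than every letter of $\sigma$. A statistic is weakly shuffle-compatible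 if whenever $\pi < \sigma$, the multiset $\{\mathrm{st}(\tau) : \tau \in \pi ⧢ \sigma\}$ depends only on $\mathrm{st}(\pi), \mathrm{st}(\sigma), |\pi|, |\sigma|$. It is substring-compatible if $\pi \sim_{\mathrm{st}} \sigma$ implies $\pi_i \cdots \pi_j \sim_{\mathrm{st}} \sigma_i \cdots \sigma_j$ for all $1 \le i \le j \le |\pi|$. It is weakly bicompatible if it is weakly shuffle-compatible and substring-compatible. For a statistic defined on length $\le n$, these conditions are imposed only when all permutations involved have length at most $n$. *)

theory Defs
  imports "HOL-Library.Multiset" "HOL-Library.Sublist" "HOL-Computational_Algebra.Primes"
begin

definition permutation :: "nat list \<Rightarrow> bool" where
  "permutation \<pi> \<longleftrightarrow> distinct \<pi> \<and> (\<forall>x \<in> set \<pi>. x > 0)"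

definition same_relative_order :: "nat list \<Rightarrow> nat list \<Rightarrow> bool" where
  "same_relative_order \<pi> \<sigma> \<longleftrightarrow> length \<pi> = length \<sigma> \<and>
     (\<forall>i < length \<pi>. \<forall>j < length \<pi>. \<pi> ! i < \<pi> ! j \<longleftrightarrow> \<sigma> ! i < \<sigma> ! j)"

text \<open>
  A statistic defined on length \<open>\<le> n\<close> is a total function whose values on lists that are not
  permutations of length at most \<open>n\<close> are arbitrary; no notion below inspects those values.
\<close>

definition permutation_statistic :: "nat \<Rightarrow> (nat list \<Rightarrow> 'a) \<Rightarrow> bool" where
  "permutation_statistic n st \<longleftrightarrow>
     (\<forall>\<pi> \<sigma>. permutation \<pi> \<longrightarrow> permutation \<sigma> \<longrightarrow> length \<pi> \<le> n \<longrightarrow>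
        same_relative_order \<pi> \<sigma> \<longrightarrow> st \<pi> = st \<sigma>)"

definition st_equiv :: "(nat list \<Rightarrow> 'a) \<Rightarrow> nat list \<Rightarrow> nat list \<Rightarrow> bool" where
  "st_equiv st \<pi> \<sigma> \<longleftrightarrow> length \<pi> = length \<sigma> \<and> st \<pi> = st \<sigma>"

definition permutations_of_length :: "nat \<Rightarrow> nat list set" where
  "permutations_of_length m = {\<pi>. permutation \<pi> \<and> length \<pi> = m}"

definition st_classes :: "(nat list \<Rightarrow> 'a) \<Rightarrow> nat \<Rightarrow> nat list set set" where
  "st_classes st m =
     permutations_of_length m //
       {(\<pi>, \<sigma>). \<pi> \<in> permutations_of_length m \<and> \<sigma> \<in> permutations_of_length m \<and> st_equiv st \<pi> \<sigma>}"

definition trivial_on_lengths :: "nat set \<Rightarrow> (nat list \<Rightarrow> 'a) \<Rightarrow> bool" where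
  "trivial_on_lengths L st \<longleftrightarrow>
     (\<forall>m \<in> L. \<forall>\<pi> \<in> permutations_of_length m. \<forall>\<sigma> \<in> permutations_of_length m. st_equiv st \<pi> \<sigma>)"

text \<open>
  The shuffle set of two disjoint permutations is the library's \<^const>\<open>shuffles\<close>.
\<close>

lemma shuffles_eq_common_superpermutations:
  assumes "permutation \<pi>" "permutation \<sigma>" "set \<pi> \<inter> set \<sigma> = {}"
  shows "shuffles \<pi> \<sigma> =
    {\<tau>. permutation \<tau> \<and> length \<tau> = length \<pi> + length \<sigma> \<and> subseq \<pi> \<tau> \<and> subseq \<sigma> \<tau>}"
proof (intro equalityI subsetI)
  fix \<tau> assume t: "\<tau> \<in> shuffles \<pi> \<sigma>"
  have "distinct \<tau>"
    using distinct_disjoint_shuffles[OF _ _ _ t] assms by (simp add: permutation_def)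
  moreover have "set \<tau> = set \<pi> \<union> set \<sigma>" by (rule set_shuffles[OF t])
  moreover have "length \<tau> = length \<pi> + length \<sigma>" by (rule length_shuffles[OF t])
  moreover have "filter (\<lambda>x. x \<in> set \<pi>) \<tau> = \<pi>" "filter (\<lambda>x. x \<notin> set \<pi>) \<tau> = \<sigma>"
    using filter_shuffles_disjoint1[OF assms(3) t] by simp_all
  hence "subseq \<pi> \<tau>" "subseq \<sigma> \<tau>"
    by (metis subseq_filter_left)+
  ultimately show "\<tau> \<in> {\<tau>. permutation \<tau> \<and> length \<tau> = length \<pi> + length \<sigma> \<and> subseq \<pi> \<tau> \<and> subseq \<sigma> \<tau>}"
    using assms by (auto simp: permutation_def)
next
  fix \<tau> assume "\<tau> \<in> {\<tau>. permutation \<tau> \<and> length \<tau> = length \<pi> + length \<sigma> \<and> subseq \<pi> \<tau> \<and> subseq \<sigma> \<tau>}"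
  hence t: "distinct \<tau>" "length \<tau> = length \<pi> + length \<sigma>" "subseq \<pi> \<tau>" "subseq \<sigma> \<tau>"
    by (auto simp: permutation_def)
  let ?P = "\<lambda>x. x \<in> set \<pi>"
  have s1: "subseq \<pi> (filter ?P \<tau>)"
    using subseq_filter[OF t(3), of ?P] by (simp add: filter_id_conv)
  have "filter (\<lambda>x. \<not> ?P x) \<sigma> = \<sigma>"
    using assms(3) by (auto simp: filter_id_conv)
  with subseq_filter[OF t(4), of "\<lambda>x. \<not> ?P x"] have s2: "subseq \<sigma> (filter (\<lambda>x. \<not> ?P x) \<tau>)"
    by simp
  have "length (filter ?P \<tau>) + length (filter (\<lambda>x. \<not> ?P x) \<tau>) = length \<tau>"
    by (rule sum_length_filter_compl)
  with t(2) list_emb_length[OF s1] list_emb_length[OF s2]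
  have "length \<pi> = length (filter ?P \<tau>)" "length \<sigma> = length (filter (\<lambda>x. \<not> ?P x) \<tau>)"
    by linarith+
  hence "\<pi> = filter ?P \<tau>" "\<sigma> = filter (\<lambda>x. \<not> ?P x) \<tau>"
    using s1 s2 by (metis subseq_same_length)+
  thus "\<tau> \<in> shuffles \<pi> \<sigma>"
    using partition_in_shuffles[of \<tau> ?P] by simp
qed

definition perm_less :: "nat list \<Rightarrow> nat list \<Rightarrow> bool" where
  "perm_less \<pi> \<sigma> \<longleftrightarrow> (\<forall>x \<in> set \<pi>. \<forall>y \<in> set \<sigma>. x < y)"

definition weakly_shuffle_compatible :: "nat \<Rightarrow> (nat list \<Rightarrow> 'a) \<Rightarrow> bool" where
  "weakly_shuffle_compatible n st \<longleftrightarrow>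
     (\<forall>\<pi> \<sigma> \<pi>' \<sigma>'.
        permutation \<pi> \<longrightarrow> permutation \<sigma> \<longrightarrow> permutation \<pi>' \<longrightarrow> permutation \<sigma>' \<longrightarrow>
        perm_less \<pi> \<sigma> \<longrightarrow> perm_less \<pi>' \<sigma>' \<longrightarrow>
        length \<pi> + length \<sigma> \<le> n \<longrightarrow>
        length \<pi> = length \<pi>' \<longrightarrow> length \<sigma> = length \<sigma>' \<longrightarrow>
        st \<pi> = st \<pi>' \<longrightarrow> st \<sigma> = st \<sigma>' \<longrightarrow>
        image_mset st (mset_set (shuffles \<pi> \<sigma>)) = image_mset st (mset_set (shuffles \<pi>' \<sigma>')))"

text \<open>
  Positions are counted from 1: \<open>substring \<pi> i j\<close> consists of the \<open>i\<close>-th to the \<open>j\<close>-th letter,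
  both included.
\<close>

definition substring :: "nat list \<Rightarrow> nat \<Rightarrow> nat \<Rightarrow> nat list" where
  "substring \<pi> i j = drop (i - 1) (take j \<pi>)"

definition substring_compatible :: "nat \<Rightarrow> (nat list \<Rightarrow> 'a) \<Rightarrow> bool" where
  "substring_compatible n st \<longleftrightarrow>
     (\<forall>\<pi> \<sigma>. permutation \<pi> \<longrightarrow> permutation \<sigma> \<longrightarrow> length \<pi> \<le> n \<longrightarrow> st_equiv st \<pi> \<sigma> \<longrightarrow>
        (\<forall>i j. 1 \<le> i \<longrightarrow> i \<le> j \<longrightarrow> j \<le> length \<pi> \<longrightarrow>
           st_equiv st (substring \<pi> i j) (substring \<sigma> i j)))"

definition weakly_bicompatible :: "nat \<Rightarrow> (nat list \<Rightarrow> 'a) \<Rightarrow> bool" where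
  "weakly_bicompatible n st \<longleftrightarrow> weakly_shuffle_compatible n st \<and> substring_compatible n st"

end

theory Submission
  imports "HOL-Algebra.Exponent" "HOL-Combinatorics.Multiset_Permutations" Defs
begin

text \<open>
  Every permutation of \<open>{1..n}\<close> lies in exactly one shuffle set of a permutation of \<open>{1..i}\<close> with one
  of \<open>{i+1..n}\<close>. As the statistic is trivial on shorter lengths, weak shuffle-compatibility makes all
  these shuffle sets meet a given level set in equally many elements. So if the level set has
  density \<open>d\<close> among the \<open>n!\<close> permutations, then \<open>d * (n choose i)\<close> is an integer for every
  \<open>0 < i < n\<close>. The greatest common divisor of these binomial coefficients is \<open>p\<close> if \<open>n\<close> is a power of
  the prime \<open>p\<close>, and 1 if \<open>n\<close> is not a prime power; hence \<open>d \<ge> 1/p\<close>, respectively \<open>d = 1\<close>.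
\<close>

section \<open>Standardization and decomposition into shuffles\<close>

lemma permutation_imp_same_order_standard:
  assumes "permutation \<pi>"
  shows "\<exists>\<tau>\<in>permutations_of_set {1..length \<pi>}. same_relative_order \<pi> \<tau>"
proof -
  let ?n = "length \<pi>"
  \<comment> \<open>The rank of a letter among all letters of \<pi>, counted from 1; applying it
    letterwise standardizes \<pi>.\<close>
  define r where "r x = card {y\<in>set \<pi>. y \<le> x}" for x
  have mono: "r x < r y" if "x \<in> set \<pi>" "y \<in> set \<pi>" "x < y" for x y
  proof -
    have "{z\<in>set \<pi>. z \<le> x} \<subset> {z\<in>set \<pi>. z \<le> y}"
      using that by (intro psubsetI) (auto simp: set_eq_iff intro!: exI[of _ y])
    thus ?thesis unfolding r_def by (intro psubset_card_mono) auto
  qed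
  have iff: "r x < r y \<longleftrightarrow> x < y" if "x \<in> set \<pi>" "y \<in> set \<pi>" for x y
    using mono that by (metis less_asym linorder_neqE_nat)
  have inj: "inj_on r (set \<pi>)"
    by (rule inj_onI) (metis iff linorder_neqE_nat less_irrefl)
  have d: "distinct \<pi>" using assms by (simp add: permutation_def)
  have sub: "r ` set \<pi> \<subseteq> {1..?n}"
  proof
    fix z assume "z \<in> r ` set \<pi>"
    then obtain x where x: "x \<in> set \<pi>" "z = r x" by blast
    have "r x \<le> card (set \<pi>)" unfolding r_def by (intro card_mono) auto
    moreover have "r x > 0" unfolding r_def using x by (auto simp: card_gt_0_iff)
    ultimately show "z \<in> {1..?n}" using x d by (simp add: distinct_card)
  qed
  have "r ` set \<pi> = {1..?n}"
    using sub card_image[OF inj] d by (intro card_subset_eq) (auto simp: distinct_card)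
  hence "map r \<pi> \<in> permutations_of_set {1..?n}"
    using d inj by (simp add: permutations_of_set_def distinct_map)
  moreover have "same_relative_order \<pi> (map r \<pi>)"
    using iff by (simp add: same_relative_order_def)
  ultimately show ?thesis by blast
qed

text \<open>The letters of \<tau> from A and those from B, each in order of appearance, form the two
  words that \<tau> shuffles.\<close>

lemma permutations_of_set_Un_eq_shuffles:
  assumes "A \<inter> B = {}"
  shows "permutations_of_set (A \<union> B) =
    (\<Union>(\<pi>, \<sigma>) \<in> permutations_of_set A \<times> permutations_of_set B. shuffles \<pi> \<sigma>)"
proof (intro equalityI subsetI)
  fix \<tau> assume t: "\<tau> \<in> permutations_of_set (A \<union> B)"
  have "\<tau> \<in> shuffles (filter (\<lambda>x. x \<in> A) \<tau>) (filter (\<lambda>x. x \<notin> A) \<tau>)"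
    by (rule partition_in_shuffles)
  moreover have "filter (\<lambda>x. x \<in> A) \<tau> \<in> permutations_of_set A"
    "filter (\<lambda>x. x \<notin> A) \<tau> \<in> permutations_of_set B"
    using t assms by (auto simp: permutations_of_set_def)
  ultimately show "\<tau> \<in> (\<Union>(\<pi>, \<sigma>) \<in> permutations_of_set A \<times> permutations_of_set B. shuffles \<pi> \<sigma>)"
    by blast
next
  fix \<tau> assume "\<tau> \<in> (\<Union>(\<pi>, \<sigma>) \<in> permutations_of_set A \<times> permutations_of_set B. shuffles \<pi> \<sigma>)"
  then obtain \<pi> \<sigma> where *: "\<pi> \<in> permutations_of_set A" "\<sigma> \<in> permutations_of_set B" "\<tau> \<in> shuffles \<pi> \<sigma>"
    by blast
  with distinct_disjoint_shuffles[OF _ _ _ *(3)] set_shuffles[OF *(3)] assms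
  show "\<tau> \<in> permutations_of_set (A \<union> B)"
    by (auto simp: permutations_of_set_def)
qed

text \<open>The union in the preceding lemma is disjoint, so the count is a sum of (card A)! (card
  B)! equal terms.\<close>

lemma card_permutations_shuffle_const:
  assumes "finite A" "finite B" "A \<inter> B = {}"
    and const: "\<And>\<pi> \<sigma>. \<pi> \<in> permutations_of_set A \<Longrightarrow> \<sigma> \<in> permutations_of_set B \<Longrightarrow>
      card {\<tau> \<in> shuffles \<pi> \<sigma>. P \<tau>} = c"
  shows "card {\<tau> \<in> permutations_of_set (A \<union> B). P \<tau>} = fact (card A) * fact (card B) * c"
proof -
  let ?I = "permutations_of_set A \<times> permutations_of_set B"
  let ?F = "\<lambda>(\<pi>, \<sigma>). {\<tau> \<in> shuffles \<pi> \<sigma>. P \<tau>}"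
  have eq: "{\<tau> \<in> permutations_of_set (A \<union> B). P \<tau>} = (\<Union>i\<in>?I. ?F i)"
    by (subst permutations_of_set_Un_eq_shuffles[OF assms(3)]) auto
  have disj: "?F i \<inter> ?F j = {}" if i: "i \<in> ?I" and j: "j \<in> ?I" and "i \<noteq> j" for i j
  proof -
    obtain \<pi> \<sigma> where 1: "i = (\<pi>, \<sigma>)" by fastforce
    obtain \<pi>' \<sigma>' where 2: "j = (\<pi>', \<sigma>')" by fastforce
    have s: "set \<pi> = A" "set \<sigma> = B" "set \<pi>' = A" "set \<sigma>' = B"
      using i j 1 2 by (auto simp: permutations_of_set_def)
    \<comment> \<open>Filtering \<tau> by membership in A recovers the pair it was shuffled from, so
      no \<tau> comes from two pairs.\<close>
    have "False" if "\<tau> \<in> shuffles \<pi> \<sigma>" "\<tau> \<in> shuffles \<pi>' \<sigma>'" for \<tau>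
    proof -
      have "set \<pi> \<inter> set \<sigma> = {}" "set \<pi>' \<inter> set \<sigma>' = {}" using s assms(3) by auto
      from filter_shuffles_disjoint1[OF this(1) that(1)] filter_shuffles_disjoint1[OF this(2) that(2)]
      have "\<pi> = \<pi>'" "\<sigma> = \<sigma>'" using s by simp_all
      thus False using 1 2 \<open>i \<noteq> j\<close> by simp
    qed
    thus ?thesis using 1 2 by auto
  qed
  have "card (\<Union>i\<in>?I. ?F i) = (\<Sum>i\<in>?I. card (?F i))"
    using disj by (intro card_UN_disjoint) (auto intro: finite_subset[OF _ finite_shuffles])
  also have "\<dots> = (\<Sum>i\<in>?I. c)"
    using const by (intro sum.cong) auto
  also have "\<dots> = fact (card A) * fact (card B) * c"
    using assms by (simp add: card_cartesian_product)
  finally show ?thesis by (simp only: eq)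
qed

section \<open>Lowest terms and common divisors of binomial coefficients\<close>

text \<open>\<open>F div gcd F a\<close> is the denominator of \<open>a / F\<close> in lowest terms.\<close>

lemma denominator_dvd:
  fixes F a m :: nat
  assumes "F > 0"
  shows "F dvd m * a \<longleftrightarrow> F div gcd F a dvd m"
proof -
  obtain F' a' where *: "F = F' * gcd F a" "a = a' * gcd F a" "coprime F' a'"
    using gcd_coprime_exists[of F a] assms by auto
  have g: "gcd F a > 0" using assms by simp
  have "F dvd m * a \<longleftrightarrow> F' * gcd F a dvd m * a' * gcd F a"
    by (subst *(1), subst (2) *(2)) (simp only: mult.assoc)
  also have "\<dots> \<longleftrightarrow> F' dvd m * a'" using g by simp
  also have "\<dots> \<longleftrightarrow> F' dvd m" using *(3) by (simp add: coprime_dvd_mult_left_iff)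
  also have "F' = F div gcd F a" using g by (subst *(1)) simp
  finally show ?thesis .
qed

text \<open>The coefficient with i = 1 is p^k, so b is a power of p; the one with i = p^(k-1)
  contains p exactly once, so the exponent is at most 1.\<close>

lemma dvd_all_binomials_prime_power:
  fixes b p k :: nat
  assumes "prime p" "k \<ge> 1" and dvd: "\<And>i. 0 < i \<Longrightarrow> i < p ^ k \<Longrightarrow> b dvd p ^ k choose i"
  shows "b dvd p"
proof -
  have p: "p > 1" using assms(1) by (rule prime_gt_1_nat)
  have n: "p ^ k = p ^ (k - 1) * p" using assms(2) by (cases k) auto
  have "1 < p ^ k" using p assms(2) by (intro one_less_power) auto
  hence "b dvd p ^ k" using dvd[of 1] by simp
  then obtain j where j: "b = p ^ j" using divides_primepow_nat[OF assms(1)] by blast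
  have lt: "p ^ (k - 1) < p ^ k" using p assms(2) by (intro power_strict_increasing) auto
  have "b dvd p ^ k choose p ^ (k - 1)" using dvd lt p by simp
  moreover have "p ^ k choose p ^ (k - 1) \<noteq> 0" using lt by simp
  ultimately have "j \<le> multiplicity p (p ^ k choose p ^ (k - 1))"
    using j p by (intro multiplicity_geI) auto
  \<comment> \<open>By \<open>const_p_fac\<close> the p-adic valuation of (p^a m choose p^a) is that
    of m; here a = k - 1 and m = p.\<close>
  also have "\<dots> = multiplicity p p" using const_p_fac[of p p "k - 1"] p assms(1) n by simp
  also have "\<dots> = 1" using p by (intro multiplicity_self) auto
  finally have "p ^ j dvd p ^ 1" by (rule le_imp_power_dvd)
  thus ?thesis by (simp add: j)
qed

text \<open>A prime q dividing b would divide n choose 1 = n. If q^a is the full power of q in n,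
  then q^a < n because n is not a prime power, yet n choose q^a is prime to q: a
  contradiction.\<close>

lemma dvd_all_binomials_not_prime_power:
  fixes b n :: nat
  assumes "n > 1" "\<nexists>p k. prime p \<and> k \<ge> 1 \<and> n = p ^ k"
    and dvd: "\<And>i. 0 < i \<Longrightarrow> i < n \<Longrightarrow> b dvd n choose i"
  shows "b = 1"
proof (rule ccontr)
  assume "b \<noteq> 1"
  then obtain q where q: "prime q" "q dvd b" using prime_factor_nat by blast
  have "q dvd n" using dvd[of 1] assms(1) q by (auto intro: dvd_trans)
  have q1: "q > 1" using q(1) by (rule prime_gt_1_nat)
  define a where "a = multiplicity q n"
  obtain m where m: "n = q ^ a * m" "\<not> q dvd m"
    using multiplicity_decompose'[of n q] q1 assms(1) unfolding a_def by auto
  have "a \<ge> 1" using m \<open>q dvd n\<close> by (cases a) auto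
  hence "m \<noteq> 1" using assms(2) q(1) m(1) by (metis mult.right_neutral)
  moreover have "m > 0" using m by (cases m) auto
  ultimately have "m > 1" by simp
  hence lt: "q ^ a < n" using m(1) q1 by simp
  hence "q dvd n choose (q ^ a)" using dvd[of "q ^ a"] q q1 by (auto intro: dvd_trans)
  moreover have "n choose (q ^ a) \<noteq> 0" using lt by simp
  ultimately have "multiplicity q (n choose (q ^ a)) \<ge> 1"
    using q1 by (intro multiplicity_geI) auto
  moreover have "multiplicity q (n choose (q ^ a)) = multiplicity q m"
    using const_p_fac[of m q a] \<open>m > 0\<close> q(1) m(1) by simp
  ultimately show False using m(2) not_dvd_imp_multiplicity_0 by force
qed

section \<open>Level sets of the statistic\<close>

text \<open>If every shuffle set contains c members of the level set, the latter has size i! (n-i)!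
  c, and the factor n choose i completes the factorials to n!.\<close>

lemma fact_dvd_binomial_mult_card_level_set:
  fixes n :: nat and st :: "nat list \<Rightarrow> 'a"
  assumes "weakly_shuffle_compatible n st" "trivial_on_lengths {..n - 1} st" "0 < i" "i < n"
  shows "fact n dvd (n choose i) * card {\<tau> \<in> permutations_of_set {1..n}. st \<tau> = v}"
proof -
  let ?A = "{1..i}" and ?B = "{i+1..n}"
  let ?c = "\<lambda>\<pi> \<sigma>. card {\<tau> \<in> shuffles \<pi> \<sigma>. st \<tau> = v}"
  have U: "?A \<union> ?B = {1..n}" and D: "?A \<inter> ?B = {}" using assms by auto
  have same: "?c \<pi> \<sigma> = ?c \<pi>' \<sigma>'"
    if "\<pi> \<in> permutations_of_set ?A" "\<sigma> \<in> permutations_of_set ?B"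
      "\<pi>' \<in> permutations_of_set ?A" "\<sigma>' \<in> permutations_of_set ?B" for \<pi> \<sigma> \<pi>' \<sigma>'
  proof -
    have len: "length \<pi> = i" "length \<pi>' = i" "length \<sigma> = n - i" "length \<sigma>' = n - i"
      using that[THEN length_finite_permutations_of_set] by auto
    have perm: "permutation \<pi>" "permutation \<pi>'" "permutation \<sigma>" "permutation \<sigma>'"
      using that by (auto simp: permutation_def permutations_of_set_def)
    have less: "perm_less \<pi> \<sigma>" "perm_less \<pi>' \<sigma>'"
      using that by (auto simp: perm_less_def permutations_of_set_def)
    have triv: "st \<alpha> = st \<beta>" if "permutation \<alpha>" "permutation \<beta>" "length \<alpha> = length \<beta>" "length \<alpha> \<le> n - 1"
      for \<alpha> \<beta>
    proof -
      have "\<alpha> \<in> permutations_of_length (length \<alpha>)" "\<beta> \<in> permutations_of_length (length \<alpha>)"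
        using that by (simp_all add: permutations_of_length_def)
      thus ?thesis
        using assms(2) that(4) unfolding trivial_on_lengths_def st_equiv_def by blast
    qed
    \<comment> \<open>As 0 < i < n, both i and n - i are at most n - 1, so triviality applies to
      both factors.\<close>
    have st: "st \<pi> = st \<pi>'" "st \<sigma> = st \<sigma>'"
      using assms(3,4) len perm triv[of \<pi> \<pi>'] triv[of \<sigma> \<sigma>'] by simp_all
    have "image_mset st (mset_set (shuffles \<pi> \<sigma>)) = image_mset st (mset_set (shuffles \<pi>' \<sigma>'))"
      by (rule assms(1)[unfolded weakly_shuffle_compatible_def, rule_format])
        (use assms(4) len perm less st in simp_all)
    hence "count (image_mset st (mset_set (shuffles \<pi> \<sigma>))) v =
      count (image_mset st (mset_set (shuffles \<pi>' \<sigma>'))) v" by simp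
    \<comment> \<open>The multiplicity of v in the image multiset is the number of shuffles with
      value v.\<close>
    thus ?thesis by (simp add: count_image_mset' eq_commute[of v])
  qed
  \<comment> \<open>An arbitrary reference pair, whose count serves as the constant c.\<close>
  obtain \<pi>\<^sub>0 \<sigma>\<^sub>0 where base: "\<pi>\<^sub>0 \<in> permutations_of_set ?A" "\<sigma>\<^sub>0 \<in> permutations_of_set ?B"
    using permutations_of_set_empty_iff[of ?A] permutations_of_set_empty_iff[of ?B] by blast
  have "card {\<tau> \<in> permutations_of_set {1..n}. st \<tau> = v} = fact i * fact (n - i) * ?c \<pi>\<^sub>0 \<sigma>\<^sub>0"
    using card_permutations_shuffle_const[OF _ _ D same[OF _ _ base]] U by simp
  moreover have "(n choose i) * (fact i * fact (n - i)) = fact n"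
    using binomial_fact_lemma[of i n] assms(4) by (simp add: ac_simps)
  ultimately have "(n choose i) * card {\<tau> \<in> permutations_of_set {1..n}. st \<tau> = v} =
      fact n * ?c \<pi>\<^sub>0 \<sigma>\<^sub>0"
    by (simp only: mult.assoc[symmetric])
  thus ?thesis by simp
qed

section \<open>From level sets to equivalence classes\<close>

text \<open>Standardization passes from arbitrary positive letters to the n! standard permutations
  without losing a value.\<close>

lemma st_image_permutations_of_length:
  assumes "permutation_statistic n st"
  shows "st ` permutations_of_length n = st ` permutations_of_set {1..n}"
proof (intro equalityI subsetI)
  fix v assume "v \<in> st ` permutations_of_length n"
  then obtain \<pi> where \<pi>: "permutation \<pi>" "length \<pi> = n" "v = st \<pi>"
    by (auto simp: permutations_of_length_def)
  obtain \<tau> where \<tau>: "\<tau> \<in> permutations_of_set {1..n}" "same_relative_order \<pi> \<tau>"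
    using permutation_imp_same_order_standard[OF \<pi>(1)] \<pi>(2) by blast
  moreover have "permutation \<tau>" using \<tau>(1) by (auto simp: permutation_def permutations_of_set_def)
  ultimately have "v = st \<tau>" using assms \<pi> unfolding permutation_statistic_def by blast
  thus "v \<in> st ` permutations_of_set {1..n}" using \<tau>(1) by blast
next
  fix v assume "v \<in> st ` permutations_of_set {1..n}"
  thus "v \<in> st ` permutations_of_length n"
    using length_finite_permutations_of_set
    by (fastforce simp: permutations_of_length_def permutation_def permutations_of_set_def)
qed

text \<open>Classes are the nonempty fibres of \<open>st\<close>, so counting them means counting
  attained values.\<close>

lemma bij_betw_st_classes:
  "bij_betw (\<lambda>v. {\<pi> \<in> permutations_of_length n. st \<pi> = v})
     (st ` permutations_of_length n) (st_classes st n)"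
proof -
  let ?f = "\<lambda>v. {\<pi> \<in> permutations_of_length n. st \<pi> = v}"
  have "inj_on ?f (st ` permutations_of_length n)" by (rule inj_onI) blast
  moreover have "st_classes st n = (\<lambda>\<pi>. ?f (st \<pi>)) ` permutations_of_length n"
  proof -
    let ?R = "{(\<pi>, \<sigma>). \<pi> \<in> permutations_of_length n \<and> \<sigma> \<in> permutations_of_length n \<and> st_equiv st \<pi> \<sigma>}"
    have len: "length \<pi> = n" if "\<pi> \<in> permutations_of_length n" for \<pi>
      using that by (simp add: permutations_of_length_def)
    have R: "?R `` {\<pi>} = ?f (st \<pi>)" if "\<pi> \<in> permutations_of_length n" for \<pi>
    proof (intro equalityI subsetI)
      fix \<sigma> assume "\<sigma> \<in> ?R `` {\<pi>}"
      thus "\<sigma> \<in> ?f (st \<pi>)" by (simp add: st_equiv_def)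
    next
      fix \<sigma> assume "\<sigma> \<in> ?f (st \<pi>)"
      thus "\<sigma> \<in> ?R `` {\<pi>}" using that by (simp add: st_equiv_def len)
    qed
    have "st_classes st n = (\<lambda>\<pi>. ?R `` {\<pi>}) ` permutations_of_length n"
      unfolding st_classes_def quotient_def by blast
    also have "\<dots> = (\<lambda>\<pi>. ?f (st \<pi>)) ` permutations_of_length n"
      by (rule image_cong[OF refl R])
    finally show ?thesis .
  qed
  ultimately show ?thesis by (simp add: bij_betw_def image_image)
qed

text \<open>The fibres partition S, and each takes up at least 1/m of it.\<close>

lemma card_image_le_if_level_sets_large:
  assumes "finite S" "S \<noteq> {}" and "\<And>v. v \<in> f ` S \<Longrightarrow> card S \<le> m * card {x \<in> S. f x = v}"
  shows "card (f ` S) \<le> m"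
proof -
  have "card (f ` S) * card S = (\<Sum>v\<in>f ` S. card S)" by simp
  also have "\<dots> \<le> (\<Sum>v\<in>f ` S. m * card {x \<in> S. f x = v})" by (intro sum_mono assms)
  also have "\<dots> = m * (\<Sum>v\<in>f ` S. \<Sum>x\<in>{x \<in> S. f x = v}. 1)" by (simp add: sum_distrib_left)
  also have "\<dots> = m * (\<Sum>x\<in>S. 1)" using sum.image_gen[OF assms(1), of "\<lambda>_. 1::nat" f] by simp
  also have "\<dots> = m * card S" by simp
  finally show ?thesis using assms(1,2) by (simp add: card_gt_0_iff)
qed

text \<open>Serves both cases, with m = p or m = 1. The assumption \<open>gcd\<close>, applied to
  the denominator of the density of a level set, makes m times that density an integer.\<close>

lemma card_st_image_le:
  fixes n m :: nat and st :: "nat list \<Rightarrow> 'a"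
  assumes "weakly_shuffle_compatible n st" "trivial_on_lengths {..n - 1} st" "m > 0"
    and gcd: "\<And>b. (\<And>i. 0 < i \<Longrightarrow> i < n \<Longrightarrow> b dvd n choose i) \<Longrightarrow> b dvd m"
  shows "card (st ` permutations_of_set {1..n}) \<le> m"
proof (rule card_image_le_if_level_sets_large)
  let ?S = "permutations_of_set {1..n}"
  show "finite ?S" "?S \<noteq> {}" by simp_all
  fix v assume v: "v \<in> st ` ?S"
  let ?a = "card {\<tau> \<in> ?S. st \<tau> = v}"
  have "fact n div gcd (fact n) ?a dvd n choose i" if "0 < i" "i < n" for i
    using fact_dvd_binomial_mult_card_level_set[OF assms(1,2) that, of v]
    by (subst denominator_dvd[symmetric]) auto
  hence "fact n div gcd (fact n) ?a dvd m" by (rule gcd)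
  hence "fact n dvd m * ?a" by (subst denominator_dvd) auto
  \<comment> \<open>Since v is attained, m times the density is a positive integer, so the density
    is at least 1/m.\<close>
  moreover have "?a > 0" using v by (auto simp: card_gt_0_iff)
  ultimately have "fact n \<le> m * ?a" using assms(3) by (intro dvd_imp_le) auto
  thus "card ?S \<le> m * ?a" by simp
qed

theorem theorem4p11:
  fixes n :: nat and st :: "nat list \<Rightarrow> 'a"
  assumes "n \<ge> 4"
    and "permutation_statistic n st"
    and "weakly_bicompatible n st"
    and "trivial_on_lengths {..n - 1} st"
  shows "(\<forall>(p::nat) (k::nat). prime p \<longrightarrow> k \<ge> 1 \<longrightarrow> n = p ^ k \<longrightarrow>
            finite (st_classes st n) \<and> card (st_classes st n) \<le> p)
       \<and> ((\<nexists>(p::nat) (k::nat). prime p \<and> k \<ge> 1 \<and> n = p ^ k) \<longrightarrow> trivial_on_lengths {n} st)"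
proof (intro conjI allI impI)
  let ?V = "st ` permutations_of_length n"
  have wsc: "weakly_shuffle_compatible n st" using assms(3) by (simp add: weakly_bicompatible_def)
  note V = st_image_permutations_of_length[OF assms(2)]
  have finV: "finite ?V" unfolding V by simp
  \<comment> \<open>\<open>card\<close> of an infinite set is 0, so the bound on the number of
    classes has content only together with finiteness.\<close>
  show "finite (st_classes st n)" using bij_betw_finite[OF bij_betw_st_classes] finV by blast
  {
    fix p k :: nat assume pk: "prime p" "k \<ge> 1" "n = p ^ k"
    have "card ?V \<le> p" unfolding V
      using dvd_all_binomials_prime_power[OF pk(1,2)] pk(1,3)
      by (intro card_st_image_le[OF wsc assms(4)]) (auto simp: prime_gt_0_nat)
    thus "card (st_classes st n) \<le> p" by (simp add: bij_betw_same_card[OF bij_betw_st_classes])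
  }
  assume np: "\<nexists>(p::nat) (k::nat). prime p \<and> k \<ge> 1 \<and> n = p ^ k"
  have "card ?V \<le> 1" unfolding V
    using dvd_all_binomials_not_prime_power[OF _ np] assms(1)
    by (intro card_st_image_le[OF wsc assms(4)]) auto
  hence "st \<pi> = st \<sigma>" if "\<pi> \<in> permutations_of_length n" "\<sigma> \<in> permutations_of_length n" for \<pi> \<sigma>
    using that card_le_Suc0_iff_eq[OF finV] by (metis One_nat_def imageI)
  moreover have "length \<pi> = n" if "\<pi> \<in> permutations_of_length n" for \<pi>
    using that by (simp add: permutations_of_length_def)
  ultimately show "trivial_on_lengths {n} st"
    unfolding trivial_on_lengths_def st_equiv_def by blast
qed

end
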